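(* Let $K$ be a field and let $P=K[x_1,\dots,x_n]$ be non-negatively $\mathbb{Z}$-graded by $W\in\mathrm{Mat}_{1,n}(\mathbb{Z})$. Let $G=(g_1,\dots,g_r)$ be a tuple of homogeneous polynomials of positive $W$-degrees which generates an ideal $I$ in $P$. For every $d\ge 1$, let $I_d=\langle G_d\rangle$. Let $Z$ denote a tuple of distinct indeterminates in $(x_1,\dots,x_n)$. (a) A tuple of homogeneous polynomials $F$ in $I$ is $Z$-separating if and only if for every $d\ge 1$ the tuple $F_d$ is $Z_d$-separating for the ideal $I_d$. (b) A tuple of homogeneous polynomials $F$ in $I$ is coherently $Z$-separating if and only if for every $d\ge 1$ the tuple $F_d$ is coherently $Z_d$-separating for the ideal $I_d$ and $F_d$ is reduced with respect to all tuples $F_{d'}$ with $d'<d$. (c) A tuple $Z$ is a best tuple of separating indeterminates for $I$ if and only if for every $d\ge 1$ the tuple $Z_d$ is a best tuple of separating indeterminates for $I_d$.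
   Context: Grading: $W=(w_1,\dots,w_n)$ defines the $\mathbb{Z}$-grading on $P$ with $\deg_W(x_i)=w_i$; it is non-negative if all $w_i\ge 0$. "Homogeneous" means $W$-homogeneous. For a tuple $S$ of $W$-homogeneous polynomials (in particular for $S=G$, $S=F$, $S=Z$) and a degree $d$, $S_d$ denotes the subtuple consisting of all elements of $S$ of $W$-degree $d$. Such a subtuple may be empty. Separating tuples: $\mathrm{Supp}(h)$ is the set of terms (power products) occurring in $h$ with nonzero coefficient; $\mathrm{LT}_\sigma(f)$ is the leading term (power product) of $f$ with respect to a term ordering $\sigma$. For a tuple $Z=(z_1,\dots,z_s)$ of distinct indeterminates, a tuple $F=(f_1,\dots,f_s)\in P^s$ is $Z$-separating if there is a term ordering $\sigma$ with $\mathrm{LT}_\sigma(f_i)=z_i$ for $i=1,\dots,s$; it is coherently $Z$-separating if $f_i=z_i-h_i$ with polynomials $h_i$ such that $z_i$ divides no term in $\mathrm{Supp}(h_j)$ for all $i,j\in\{1,\dots,s\}$. A tuple is "in $I$" if all its entries lie in $I$. That a tuple is (coherently) $Z_d$-separating "for the ideal $I_d$" means that it is a (coherently) $Z_d$-separating tuple of polynomials in $I_d$. "$F_d$ is reduced with respect to $F_{d'}$" means that no term in the support of an entry of $F_d$ is divisible by an indeterminate in $Z_{d'}$ (these being the leading terms of the entries of $F_{d'}$). Best tuple: let $\mathfrak{M}=\langle x_1,\dots,x_n\rangle$, let $J\subseteq\mathfrak{M}$ be an ideal, and let $\mathrm{Lin}_{\mathfrak{M}}(J)$ be the $K$-vector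 space generated by the linear parts (components of standard degree $1$) of the polynomials in $J$. Let $s\le\dim_K(\mathrm{Lin}_{\mathfrak{M}}(J))$ be the largest number such that there exist a tuple of distinct indeterminates $Z=(z_1,\dots,z_s)$ and a coherently $Z$-separating tuple of polynomials in $J$. Such a tuple $Z$ is called a best tuple of separating indeterminates for $J$.
   Formalization: In (a),(b), "only if" is proved with ⟨G_1,…,G_d⟩ in place of I_d, and with I_d itself only when every F_d lies in I_d; F and Z have equal length and F_d, Z_d are matched by position; in (c) the right side also requires all entries of Z to have positive degree. *)

theory Defs
  imports Complex_Main "HOL-Library.Poly_Mapping"
begin

(* The indeterminates are indexed by a finite type 'n, so that 'n \<Rightarrow>\<^sub>0 nat is the monoid of terms
   (written additively), and ('n, 'k) mpoly is K[x_1,...,x_n]; Supp is Poly_Mapping.keys. *)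

type_synonym 'n pterm = "'n \<Rightarrow>\<^sub>0 nat"
type_synonym ('n, 'k) mpoly = "'n pterm \<Rightarrow>\<^sub>0 'k"

definition var_term :: "'n \<Rightarrow> 'n pterm" where
  "var_term x = Poly_Mapping.single x 1"

definition var :: "'n \<Rightarrow> ('n, 'k::{zero,one}) mpoly" where
  "var x = Poly_Mapping.single (var_term x) 1"

definition var_dvd :: "'n \<Rightarrow> 'n pterm \<Rightarrow> bool" where
  "var_dvd x t \<longleftrightarrow> (\<exists>u. t = var_term x + u)"

lemma module_times: "module ((*) :: 'a \<Rightarrow> 'a \<Rightarrow> 'a::comm_ring_1)"
  by unfold_locales (simp_all add: algebra_simps)

(* the ideal generated by a set *)
abbreviation ideal_gen :: "'a::comm_ring_1 set \<Rightarrow> 'a set" where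
  "ideal_gen \<equiv> module.span (*)"


(* A tuple (s_1,...,s_r) is a map with domain {1..r}.  A subtuple is a restriction of that map:
   its entries keep the positions they have in the full tuple, so that entries of subtuples of
   F and Z are compared with each other when they stand at the same position. *)

type_synonym 'a tuple = "nat \<rightharpoonup> 'a"

definition subtuple :: "('a \<Rightarrow> bool) \<Rightarrow> 'a tuple \<Rightarrow> 'a tuple" where
  "subtuple P S = S |` {i. \<exists>a. S i = Some a \<and> P a}"

definition distinct_entries :: "'a tuple \<Rightarrow> bool" where
  "distinct_entries S \<longleftrightarrow> inj_on S (dom S)"

definition wdeg :: "('n::finite \<Rightarrow> int) \<Rightarrow> 'n pterm \<Rightarrow> int" where
  "wdeg W t = (\<Sum>x\<in>UNIV. W x * int (Poly_Mapping.lookup t x))"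

(* The zero polynomial is homogeneous of every degree. *)
definition homogeneous :: "('n::finite \<Rightarrow> int) \<Rightarrow> int \<Rightarrow> ('n, 'k::zero) mpoly \<Rightarrow> bool" where
  "homogeneous W d f \<longleftrightarrow> (\<forall>t\<in>Poly_Mapping.keys f. wdeg W t = d)"

(* S_d for a tuple S of polynomials, and Z_d for a tuple Z of indeterminates *)
definition deg_polys ::
    "('n::finite \<Rightarrow> int) \<Rightarrow> int \<Rightarrow> ('n, 'k::zero) mpoly tuple \<Rightarrow> ('n, 'k) mpoly tuple" where
  "deg_polys W d S = subtuple (homogeneous W d) S"

definition deg_vars :: "('n \<Rightarrow> int) \<Rightarrow> int \<Rightarrow> 'n tuple \<Rightarrow> 'n tuple" where
  "deg_vars W d Z = subtuple (\<lambda>z. W z = d) Z"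

(* I_d = <G_d> *)
definition deg_ideal ::
    "('n::finite \<Rightarrow> int) \<Rightarrow> int \<Rightarrow> ('n, 'k::comm_ring_1) mpoly tuple \<Rightarrow> ('n, 'k) mpoly set" where
  "deg_ideal W d G = ideal_gen (ran (deg_polys W d G))"

(* <G_1, ..., G_d> = I_1 + ... + I_d.  A homogeneous element of degree d of I lies in this ideal,
   but in general not in I_d: for deg x = 1, deg y = 2, G = (x, y - x^2), the element y of I has
   degree 2 and is not in I_2 = <y - x^2>. *)
definition deg_le_ideal ::
    "('n::finite \<Rightarrow> int) \<Rightarrow> int \<Rightarrow> ('n, 'k::comm_ring_1) mpoly tuple \<Rightarrow> ('n, 'k) mpoly set" where
  "deg_le_ideal W d G = ideal_gen (\<Union>e\<in>{1..d}. ran (deg_polys W e G))"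


definition term_ordering :: "'n pterm rel \<Rightarrow> bool" where
  "term_ordering \<sigma> \<longleftrightarrow> linear_order \<sigma> \<and> (\<forall>t. (0, t) \<in> \<sigma>) \<and>
     (\<forall>s t u. (s, t) \<in> \<sigma> \<longrightarrow> (s + u, t + u) \<in> \<sigma>)"

(* LT(f) = t; a relation, because the zero polynomial has no leading term *)
definition is_LT :: "'n pterm rel \<Rightarrow> ('n, 'k::zero) mpoly \<Rightarrow> 'n pterm \<Rightarrow> bool" where
  "is_LT \<sigma> f t \<longleftrightarrow> t \<in> Poly_Mapping.keys f \<and> (\<forall>u\<in>Poly_Mapping.keys f. (u, t) \<in> \<sigma>)"

definition separating :: "'n tuple \<Rightarrow> ('n, 'k::zero) mpoly tuple \<Rightarrow> bool" where
  "separating Z F \<longleftrightarrow> dom F = dom Z \<and>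
     (\<exists>\<sigma>. term_ordering \<sigma> \<and> (\<forall>i\<in>dom Z. is_LT \<sigma> (the (F i)) (var_term (the (Z i)))))"

definition coherently_separating :: "'n tuple \<Rightarrow> ('n, 'k::comm_ring_1) mpoly tuple \<Rightarrow> bool" where
  "coherently_separating Z F \<longleftrightarrow> dom F = dom Z \<and>
     (\<exists>h. (\<forall>i\<in>dom Z. the (F i) = var (the (Z i)) - h i) \<and>
          (\<forall>i\<in>dom Z. \<forall>j\<in>dom Z. \<forall>t\<in>Poly_Mapping.keys (h j). \<not> var_dvd (the (Z i)) t))"

definition separating_for ::
    "('n, 'k::zero) mpoly set \<Rightarrow> 'n tuple \<Rightarrow> ('n, 'k) mpoly tuple \<Rightarrow> bool" where
  "separating_for J Z F \<longleftrightarrow> separating Z F \<and> ran F \<subseteq> J"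

definition coherently_separating_for ::
    "('n, 'k::comm_ring_1) mpoly set \<Rightarrow> 'n tuple \<Rightarrow> ('n, 'k) mpoly tuple \<Rightarrow> bool" where
  "coherently_separating_for J Z F \<longleftrightarrow> coherently_separating Z F \<and> ran F \<subseteq> J"

(* Z' is the tuple of leading terms of the tuple with respect to which F is reduced. *)
definition reduced_wrt :: "'n tuple \<Rightarrow> ('n, 'k::zero) mpoly tuple \<Rightarrow> bool" where
  "reduced_wrt Z' F \<longleftrightarrow> (\<forall>f\<in>ran F. \<forall>t\<in>Poly_Mapping.keys f. \<forall>z\<in>ran Z'. \<not> var_dvd z t)"


definition hom_component ::
    "('n::finite \<Rightarrow> int) \<Rightarrow> int \<Rightarrow> ('n, 'k::comm_monoid_add) mpoly \<Rightarrow> ('n, 'k) mpoly" where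
  "hom_component W d f = 
     (\<Sum>t\<in>{t \<in> Poly_Mapping.keys f. wdeg W t = d}. Poly_Mapping.single t (Poly_Mapping.lookup f t))"

definition linear_part :: "('n::finite, 'k::comm_monoid_add) mpoly \<Rightarrow> ('n, 'k) mpoly" where
  "linear_part f = hom_component (\<lambda>_. 1) 1 f"

definition scale :: "'k::comm_ring_1 \<Rightarrow> ('n, 'k) mpoly \<Rightarrow> ('n, 'k) mpoly" where
  "scale c f = Poly_Mapping.single 0 c * f"

lemma vector_space_scale:
  "vector_space (scale :: 'k::field \<Rightarrow> ('n, 'k) mpoly \<Rightarrow> ('n, 'k) mpoly)"
proof
  fix a b :: 'k and x y :: "('n, 'k) mpoly"
  show "scale a (x + y) = scale a x + scale a y"
    by (simp add: scale_def distrib_left)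
  show "scale (a + b) x = scale a x + scale b x"
    by (simp add: scale_def single_add distrib_right)
  show "scale a (scale b x) = scale (a * b) x"
    by (simp add: scale_def mult_single mult.assoc[symmetric])
  show "scale 1 x = x"
    by (simp add: scale_def)
qed

definition Lin :: "('n::finite, 'k::field) mpoly set \<Rightarrow> ('n, 'k) mpoly set" where
  "Lin J = module.span scale (linear_part ` J)"

(* Z is a best tuple of separating indeterminates for J.  The entries of Z may carry arbitrary
   positions, since Z can be a subtuple; the length of Z is card (dom Z). *)
definition admissible_tuple :: "('n::finite, 'k::field) mpoly set \<Rightarrow> 'n tuple \<Rightarrow> bool" where
  "admissible_tuple J Z \<longleftrightarrow> finite (dom Z) \<and> distinct_entries Z \<and>
     card (dom Z) \<le> vector_space.dim scale (Lin J) \<and> (\<exists>F. coherently_separating_for J Z F)"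

definition best_tuple :: "('n::finite, 'k::field) mpoly set \<Rightarrow> 'n tuple \<Rightarrow> bool" where
  "best_tuple J Z \<longleftrightarrow> admissible_tuple J Z \<and>
     (\<forall>Z'. admissible_tuple J Z' \<longrightarrow> card (dom Z') \<le> card (dom Z))"

end

(* (a), (b): every entry of F lies in I, hence has positive degree, and the indeterminate z_i is one
   of its terms, so matching degrees means matching W z_i with deg f_i.  Term orderings sigma_d for
   the F_d are glued lexicographically: compare the parts of two terms in the indeterminates of
   degree d by sigma_d, the highest d first.

   (c): a coherently separating tuple of I may be replaced by its homogeneous components z - h of
   degree W z.  Such a component is in I_d up to products of terms of positive degrees < d, which
   involve no indeterminate of degree d, so Z_d remains coherently separating for I_d.  Conversely,
   coherently Z_d-separating tuples in I_d for all d are combined by reducing each h modulo the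
   indeterminates of smaller degree.  Hence the maximal length for I is the sum of those for
   the I_d. *)
theory Submission
  imports Defs
begin

interpretation ideal: module "(*) :: 'a::comm_ring_1 \<Rightarrow> 'a \<Rightarrow> 'a"
  by (rule module_times)

lemma ideal_gen_mult_left: "f \<in> ideal_gen S \<Longrightarrow> p * f \<in> ideal_gen S"
  by (rule ideal.span_scale)

subsection \<open>Terms and degrees\<close>

lemma var_dvd_iff: "var_dvd x t \<longleftrightarrow> Poly_Mapping.lookup t x \<noteq> 0"
proof
  assume "var_dvd x t"
  then show "Poly_Mapping.lookup t x \<noteq> 0"
    by (auto simp: var_dvd_def var_term_def lookup_add)
next
  assume nz: "Poly_Mapping.lookup t x \<noteq> 0"
  \<comment> \<open>Subtraction of exponents is truncated, so this identity holds only because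
    \<open>x\<close> has a positive exponent in \<open>t\<close>.\<close>
  have "t = var_term x + (t - var_term x)"
    by (rule poly_mapping_eqI)
      (use nz in \<open>auto simp: var_term_def lookup_add lookup_minus lookup_single when_def\<close>)
  then show "var_dvd x t"
    unfolding var_dvd_def by blast
qed

lemma var_dvd_add: "var_dvd x (s + t) \<longleftrightarrow> var_dvd x s \<or> var_dvd x t"
  by (simp add: var_dvd_iff lookup_add)

lemma var_dvd_zero [simp]: "\<not> var_dvd x 0"
  by (simp add: var_dvd_iff)

lemma var_dvd_var_term [simp]: "var_dvd x (var_term y) \<longleftrightarrow> x = y"
  by (auto simp: var_dvd_iff var_term_def lookup_single when_def)

lemma var_term_inject [simp]: "var_term x = var_term y \<longleftrightarrow> x = y"
  by (metis var_dvd_var_term)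

text \<open>Exponents add up to those of \<open>x\<close>, so only one factor can carry the single
  exponent 1.\<close>

lemma var_term_eq_add:
  assumes "var_term x = u + v"
  shows "u = 0 \<and> v = var_term x \<or> u = var_term x \<and> v = 0"
proof -
  have *: "Poly_Mapping.lookup u y + Poly_Mapping.lookup v y = (1 when x = y)" for y
    by (metis assms lookup_add var_term_def lookup_single)
  have u0: "Poly_Mapping.lookup u y = 0" and v0: "Poly_Mapping.lookup v y = 0" if "y \<noteq> x" for y
    using *[of y] that by auto
  consider "Poly_Mapping.lookup u x = 0" | "Poly_Mapping.lookup v x = 0"
    using *[of x] by (simp, linarith)
  then show ?thesis
  proof cases
    case 1
    then have "u = 0"
      using u0 by (metis poly_mapping_eqI lookup_zero)
    then show ?thesis using assms by simp
  next
    case 2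
    then have "v = 0"
      using v0 by (metis poly_mapping_eqI lookup_zero)
    then show ?thesis using assms by simp
  qed
qed

lemma wdeg_zero [simp]: "wdeg W 0 = 0"
  by (simp add: wdeg_def)

lemma wdeg_add: "wdeg W (s + t) = wdeg W s + wdeg W t"
  by (simp add: wdeg_def lookup_add algebra_simps sum.distrib)

lemma wdeg_var_term [simp]: "wdeg W (var_term x) = W x"
proof -
  have "wdeg W (var_term x) = (\<Sum>y\<in>UNIV. if x = y then W y else 0)"
    unfolding wdeg_def by (rule sum.cong) (auto simp: var_term_def lookup_single when_def)
  then show ?thesis by simp
qed

lemma wdeg_nonneg:
  assumes "\<And>x. 0 \<le> W x"
  shows "0 \<le> wdeg W t"
  unfolding wdeg_def by (intro sum_nonneg mult_nonneg_nonneg) (auto simp: assms)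

lemma wdeg_ge_var:
  assumes "\<And>x. 0 \<le> W x" "var_dvd x t"
  shows "W x \<le> wdeg W t"
  using assms(2) wdeg_nonneg[of W, OF assms(1)] by (auto simp: var_dvd_def wdeg_add)

text \<open>Splitting off any indeterminate leaves a cofactor of standard degree 0, which no
  indeterminate divides.\<close>

lemma standard_degree_one:
  assumes "wdeg (\<lambda>_. 1) t = 1"
  obtains x where "t = var_term x"
proof -
  have "t \<noteq> 0" using assms by auto
  then obtain x where x: "var_dvd x t"
    unfolding var_dvd_iff by (metis poly_mapping_eqI lookup_zero)
  then obtain u where u: "t = var_term x + u" by (auto simp: var_dvd_def)
  then have u0: "wdeg (\<lambda>_. 1) u = 0"
    using assms by (simp add: wdeg_add)
  have "\<not> var_dvd y u" for y
    using wdeg_ge_var[of "\<lambda>_. 1" y u] u0 by auto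
  then have "u = 0"
    unfolding var_dvd_iff by (metis poly_mapping_eqI lookup_zero)
  with u that show thesis by simp
qed

subsection \<open>Supports and homogeneous components\<close>

lemma keys_times_cases:
  assumes "t \<in> Poly_Mapping.keys (p * q)"
  obtains u v where "u \<in> Poly_Mapping.keys p" "v \<in> Poly_Mapping.keys q" "t = u + v"
  using assms keys_mult[of p q] by blast

lemma keys_add_cases:
  assumes "t \<in> Poly_Mapping.keys (p + q)"
  obtains "t \<in> Poly_Mapping.keys p" | "t \<in> Poly_Mapping.keys q"
  using assms keys_add[of p q] by blast

lemma keys_minus_cases:
  fixes p q :: "_ \<Rightarrow>\<^sub>0 _::ab_group_add"
  assumes "t \<in> Poly_Mapping.keys (p - q)"
  obtains "t \<in> Poly_Mapping.keys p" | "t \<in> Poly_Mapping.keys q"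
  using assms by (force simp: in_keys_iff lookup_minus)

lemma keys_var [simp]:
  "Poly_Mapping.keys (var x :: ('n, 'k::zero_neq_one) mpoly) = {var_term x}"
  by (simp add: var_def)

lemma poly_mapping_expand: "p = (\<Sum>t\<in>Poly_Mapping.keys p. Poly_Mapping.single t (Poly_Mapping.lookup p t))"
  by (rule poly_mapping_eqI) (auto simp: lookup_sum lookup_single when_def in_keys_iff)

lemma lookup_hom_component:
  "Poly_Mapping.lookup (hom_component W d f) t = (Poly_Mapping.lookup f t when wdeg W t = d)"
  by (auto simp: hom_component_def lookup_sum lookup_single when_def in_keys_iff)

lemma keys_hom_component:
  "Poly_Mapping.keys (hom_component W d f) = {t \<in> Poly_Mapping.keys f. wdeg W t = d}"
  by (auto simp: in_keys_iff lookup_hom_component)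

lemma hom_component_add: "hom_component W d (f + g) = hom_component W d f + hom_component W d g"
  by (rule poly_mapping_eqI) (simp add: lookup_hom_component lookup_add when_add_distrib)

lemma hom_component_minus:
  fixes f g :: "('n::finite, 'k::ab_group_add) mpoly"
  shows "hom_component W d (f - g) = hom_component W d f - hom_component W d g"
  by (rule poly_mapping_eqI) (simp add: lookup_hom_component lookup_minus when_diff_distrib)

lemma hom_component_zero [simp]: "hom_component W d 0 = 0"
  by (rule poly_mapping_eqI) (simp add: lookup_hom_component)

lemma hom_component_homogeneous:
  assumes "homogeneous W e f"
  shows "hom_component W d f = (if d = e then f else 0)"
  using assms
  by (intro poly_mapping_eqI) (auto simp: lookup_hom_component homogeneous_def in_keys_iff when_def)

lemma homogeneous_times:
  assumes "homogeneous W d p" "homogeneous W e q"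
  shows "homogeneous W (d + e) (p * q)"
  using assms by (auto simp: homogeneous_def wdeg_add elim!: keys_times_cases)

lemma homogeneous_var: "homogeneous W (W x) (var x :: ('n::finite, 'k::zero_neq_one) mpoly)"
  by (simp add: homogeneous_def)

lemma hom_component_sum: "hom_component W d (sum f A) = (\<Sum>a\<in>A. hom_component W d (f a))"
  by (induction A rule: infinite_finite_induct) (auto simp: hom_component_add)

text \<open>Both sides are additive in \<open>p\<close>, so it suffices to treat the monomials of
  \<open>p\<close>, which are homogeneous.\<close>

lemma hom_component_mult_homogeneous:
  fixes p :: "('n::finite, 'k::comm_ring_1) mpoly"
  assumes "homogeneous W e g"
  shows "hom_component W d (p * g) = hom_component W (d - e) p * g"
proof -
  let ?m = "\<lambda>t. Poly_Mapping.single t (Poly_Mapping.lookup p t)"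
  have hom_m: "homogeneous W (wdeg W t) (?m t)" for t
    by (auto simp: homogeneous_def)
  have m: "hom_component W d (?m t * g) = hom_component W (d - e) (?m t) * g" for t
    using homogeneous_times[OF hom_m assms, of t]
    by (auto simp: hom_component_homogeneous hom_component_homogeneous[OF hom_m])
  have "hom_component W d ((\<Sum>t\<in>Poly_Mapping.keys p. ?m t) * g) =
      hom_component W (d - e) (\<Sum>t\<in>Poly_Mapping.keys p. ?m t) * g"
    by (simp add: sum_distrib_right hom_component_sum m)
  then show ?thesis
    by (simp flip: poly_mapping_expand)
qed

lemma hom_component_eq_zero:
  assumes "\<And>x. 0 \<le> W x" "d < 0"
  shows "hom_component W d f = 0"
proof (rule poly_mapping_eqI)
  fix t
  have "wdeg W t \<noteq> d" using wdeg_nonneg[of W t, OF assms(1)] assms(2) by auto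
  then show "Poly_Mapping.lookup (hom_component W d f) t = Poly_Mapping.lookup 0 t"
    by (simp add: lookup_hom_component)
qed

subsection \<open>Ideals generated by homogeneous polynomials of positive degree\<close>

text \<open>Multiplication cannot lower degrees when the weights are non-negative. With
  \<open>d = 1\<close> this shows that every term of an element of I has positive degree.\<close>

lemma wdeg_ge_of_ideal_gen:
  fixes S :: "('n::finite, 'k::comm_ring_1) mpoly set"
  assumes nonneg: "\<And>x. 0 \<le> W x"
    and hom: "\<And>g. g \<in> S \<Longrightarrow> \<exists>e\<ge>d. homogeneous W e g"
    and "f \<in> ideal_gen S" "t \<in> Poly_Mapping.keys f"
  shows "d \<le> wdeg W t"
  using assms(3,4)
proof (induction arbitrary: t rule: ideal.span_induct_alt)
  case base
  then show ?case by simp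
next
  case (step p g f)
  from step.prems show ?case
  proof (cases rule: keys_add_cases)
    case 1
    then obtain u v where uv: "v \<in> Poly_Mapping.keys g" "t = u + v"
      by (auto elim: keys_times_cases)
    then have "d \<le> wdeg W v"
      using hom[OF step.hyps(1)] by (auto simp: homogeneous_def)
    then show ?thesis
      using uv wdeg_nonneg[of W u, OF nonneg] by (simp add: wdeg_add)
  next
    case 2
    then show ?thesis by (rule step.IH)
  qed
qed

text \<open>The component of degree \<open>d\<close> of a multiple of \<open>g\<close> is again a
  multiple of \<open>g\<close>, and it vanishes when \<open>g\<close> has degree above
  \<open>d\<close>.\<close>

lemma hom_component_in_ideal_gen:
  fixes S :: "('n::finite, 'k::comm_ring_1) mpoly set"
  assumes nonneg: "\<And>x. 0 \<le> W x"
    and hom: "\<And>g. g \<in> S \<Longrightarrow> \<exists>e\<ge>1. homogeneous W e g"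
    and "f \<in> ideal_gen S"
  shows "hom_component W d f \<in> ideal_gen {g \<in> S. \<exists>e\<in>{1..d}. homogeneous W e g}" (is "_ \<in> ?J")
  using assms(3)
proof (induction rule: ideal.span_induct_alt)
  case base
  then show ?case by (simp add: ideal.span_zero)
next
  case (step p g f)
  obtain e where e: "e \<ge> 1" "homogeneous W e g"
    using hom[OF step.hyps(1)] by blast
  have "hom_component W (d - e) p * g \<in> ?J"
  proof (cases "e \<le> d")
    case True
    then have "g \<in> ?J"
      using e step.hyps(1) by (intro ideal.span_base) auto
    then show ?thesis by (rule ideal_gen_mult_left)
  next
    case False
    then show ?thesis
      by (simp add: hom_component_eq_zero[of W, OF nonneg] ideal.span_zero)
  qed
  then show ?case
    using step.IH by (simp add: hom_component_add hom_component_mult_homogeneous[OF e(2)] ideal.span_add)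
qed

text \<open>A product of two homogeneous polynomials of positive degrees adding up to \<open>d\<close> involves no
  indeterminate of degree \<open>\<ge> d\<close>; so generators of degree \<open>< d\<close> only contribute to the remainder \<open>r\<close>.\<close>

lemma hom_component_split:
  fixes S :: "('n::finite, 'k::comm_ring_1) mpoly set"
  assumes nonneg: "\<And>x. 0 \<le> W x"
    and hom: "\<And>g. g \<in> S \<Longrightarrow> \<exists>e\<ge>1. homogeneous W e g"
    and "f \<in> ideal_gen S"
  shows "\<exists>r. hom_component W d f - r \<in> ideal_gen {g \<in> S. homogeneous W d g} \<and>
      (\<forall>t\<in>Poly_Mapping.keys r. \<forall>x. var_dvd x t \<longrightarrow> W x < d)"
  using assms(3)
proof (induction rule: ideal.span_induct_alt)
  case base
  then show ?case by (intro exI[of _ 0]) (simp add: ideal.span_zero)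
next
  case (step p g f)
  let ?J = "ideal_gen {g \<in> S. homogeneous W d g}"
  obtain r where r: "hom_component W d f - r \<in> ?J"
      "\<And>t x. t \<in> Poly_Mapping.keys r \<Longrightarrow> var_dvd x t \<Longrightarrow> W x < d"
    using step.IH by blast
  obtain e where e: "e \<ge> 1" "homogeneous W e g"
    using hom[OF step.hyps(1)] by blast
  let ?q = "hom_component W (d - e) p"
  have comp: "hom_component W d (p * g + f) = ?q * g + hom_component W d f"
    by (simp add: hom_component_add hom_component_mult_homogeneous[OF e(2)])
  consider "e = d" | "d < e" | "e < d" by linarith
  then show ?case
  proof cases
    case 1
    \<comment> \<open>Here \<open>?q\<close> has degree 0 but may involve indeterminates of weight
      0. This does no harm, since \<open>?q * g\<close> lies in \<open>?J\<close> and
      \<open>r\<close> is kept.\<close>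
    then have "g \<in> ?J" using e step.hyps(1) by (intro ideal.span_base) auto
    then have "?q * g + (hom_component W d f - r) \<in> ?J"
      using r(1) by (intro ideal.span_add ideal_gen_mult_left)
    then show ?thesis
      using r(2) unfolding comp add_diff_eq by blast
  next
    case 2
    then show ?thesis
      using r by (intro exI[of _ r]) (auto simp: comp hom_component_eq_zero[of W, OF nonneg])
  next
    case 3
    have "W x < d" if "t \<in> Poly_Mapping.keys (?q * g + r)" "var_dvd x t" for t x
      using that(1)
    proof (cases rule: keys_add_cases)
      case 1
      then obtain u v where uv: "u \<in> Poly_Mapping.keys ?q" "v \<in> Poly_Mapping.keys g" "t = u + v"
        by (auto elim: keys_times_cases)
      then have "wdeg W u = d - e" "wdeg W v = e"
        using e(2) by (auto simp: keys_hom_component homogeneous_def)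
      moreover have "W x \<le> wdeg W u \<or> W x \<le> wdeg W v"
        using that(2) uv(3) wdeg_ge_var[of W x u, OF nonneg] wdeg_ge_var[of W x v, OF nonneg]
        by (auto simp: var_dvd_add)
      ultimately show ?thesis using 3 e(1) by linarith
    next
      case 2
      then show ?thesis using r(2) that(2) by blast
    qed
    then show ?thesis
      using r(1) by (intro exI[of _ "?q * g + r"]) (auto simp: comp)
  qed
qed

text \<open>A generator of nonzero degree has no constant term, so an indeterminate can occur in a
  multiple of it only if it already occurs in the generator.\<close>

lemma var_term_in_keys_ideal_gen:
  fixes S :: "('n::finite, 'k::comm_ring_1) mpoly set"
  assumes hom: "\<And>g. g \<in> S \<Longrightarrow> homogeneous W d g" and "d \<noteq> 0"
    and "f \<in> ideal_gen S" "var_term z \<in> Poly_Mapping.keys f"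
  shows "W z = d"
  using assms(3,4)
proof (induction rule: ideal.span_induct_alt)
  case base
  then show ?case by simp
next
  case (step p g f)
  from step.prems show ?case
  proof (cases rule: keys_add_cases)
    case 1
    then obtain u v where uv: "v \<in> Poly_Mapping.keys g" "var_term z = u + v"
      by (auto elim: keys_times_cases)
    then have v: "wdeg W v = d"
      using hom[OF step.hyps(1)] by (auto simp: homogeneous_def)
    then have "v \<noteq> 0" using \<open>d \<noteq> 0\<close> by auto
    then have "v = var_term z" using var_term_eq_add[OF uv(2)] by auto
    then show ?thesis using v by simp
  next
    case 2
    then show ?thesis by (rule step.IH)
  qed
qed

subsection \<open>Sets of separating indeterminates\<close>

definition free_of :: "'n set \<Rightarrow> ('n, 'k::zero) mpoly \<Rightarrow> bool" where
  "free_of A p \<longleftrightarrow> (\<forall>t\<in>Poly_Mapping.keys p. \<forall>x\<in>A. \<not> var_dvd x t)"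

text \<open>Coherent separation expressed through the set of indeterminates alone. Best tuples are a
  matter of counting, which is easier without positions.\<close>

definition separable :: "('n, 'k::comm_ring_1) mpoly set \<Rightarrow> 'n set \<Rightarrow> bool" where
  "separable J A \<longleftrightarrow> (\<forall>z\<in>A. \<exists>h. var z - h \<in> J \<and> free_of A h)"

lemma free_of_add: "free_of A p \<Longrightarrow> free_of A q \<Longrightarrow> free_of A (p + q)"
  unfolding free_of_def by (blast elim: keys_add_cases)

lemma free_of_times: "free_of A p \<Longrightarrow> free_of A q \<Longrightarrow> free_of A (p * q)"
  unfolding free_of_def by (blast elim: keys_times_cases dest: iffD1[OF var_dvd_add])

lemma var_term_in_keys_var_minus:
  fixes h :: "('n, 'k::comm_ring_1) mpoly"
  assumes "free_of A h" "x \<in> A"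
  shows "var_term x \<in> Poly_Mapping.keys (var z - h) \<longleftrightarrow> x = z"
proof -
  have "var_term x \<notin> Poly_Mapping.keys h"
    using assms by (metis free_of_def var_dvd_var_term)
  then show ?thesis
    by (auto simp: in_keys_iff lookup_minus var_def lookup_single when_def)
qed

lemma card_dom_eq_card_ran:
  assumes "distinct_entries Z"
  shows "card (dom Z) = card (ran Z)"
proof -
  have "Some ` ran Z = Z ` dom Z"
    by (auto simp: ran_def dom_def image_iff) metis+
  moreover have "card (Z ` dom Z) = card (dom Z)"
    using assms by (auto simp: distinct_entries_def card_image)
  moreover have "card (Some ` ran Z) = card (ran Z)"
    by (simp add: card_image)
  ultimately show ?thesis by simp
qed

lemma finite_dom_of_distinct:
  fixes Z :: "'n::finite tuple"
  assumes "distinct_entries Z"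
  shows "finite (dom Z)"
  using assms unfolding distinct_entries_def by (rule finite_imageD[rotated]) simp

lemma distinct_tuple_of_set:
  fixes A :: "'n::finite set"
  obtains Z :: "'n tuple" where "distinct_entries Z" "ran Z = A"
proof -
  obtain f :: "nat \<Rightarrow> 'n" and n where f: "A = f ` {i. i < n}" "inj_on f {i. i < n}"
    using finite_imp_nat_seg_image_inj_on[of A] by auto
  let ?Z = "\<lambda>i. if i < n then Some (f i) else None"
  have "distinct_entries ?Z"
    using f(2) by (auto simp: distinct_entries_def inj_on_def split: if_splits)
  moreover have "ran ?Z = A"
    using f(1) by (auto simp: ran_def)
  ultimately show ?thesis by (rule that)
qed

text \<open>The remainder is chosen as a function of the indeterminate and not of the position, so a
  repeated entry of \<open>Z\<close> simply receives the same polynomial twice.\<close>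

lemma ex_coherently_separating_for_iff:
  fixes J :: "('n, 'k::comm_ring_1) mpoly set"
  shows "(\<exists>F. coherently_separating_for J Z F) \<longleftrightarrow> separable J (ran Z)"
proof
  assume "\<exists>F. coherently_separating_for J Z F"
  then obtain F h where F: "dom F = dom Z" "ran F \<subseteq> J"
      and h: "\<And>i. i \<in> dom Z \<Longrightarrow> the (F i) = var (the (Z i)) - h i"
        "\<And>i j t. i \<in> dom Z \<Longrightarrow> j \<in> dom Z \<Longrightarrow> t \<in> Poly_Mapping.keys (h j) \<Longrightarrow> \<not> var_dvd (the (Z i)) t"
    unfolding coherently_separating_for_def coherently_separating_def by blast
  show "separable J (ran Z)"
    unfolding separable_def
  proof
    fix z assume "z \<in> ran Z"
    then obtain i where i: "Z i = Some z" by (auto simp: ran_def)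
    then have "F i = Some (var z - h i)"
      using h(1)[of i] F(1) by (cases "F i") (auto simp: domI domIff)
    then have "var z - h i \<in> J" using F(2) by (auto simp: ran_def)
    moreover have "free_of (ran Z) (h i)"
      unfolding free_of_def
    proof (intro ballI)
      fix t x assume t: "t \<in> Poly_Mapping.keys (h i)" and "x \<in> ran Z"
      then obtain j where "Z j = Some x" by (auto simp: ran_def)
      then show "\<not> var_dvd x t"
        using h(2)[of j i t] i t by (auto simp: domI)
    qed
    ultimately show "\<exists>h. var z - h \<in> J \<and> free_of (ran Z) h" by blast
  qed
next
  assume "separable J (ran Z)"
  then obtain h where h: "\<And>z. z \<in> ran Z \<Longrightarrow> var z - h z \<in> J \<and> free_of (ran Z) (h z)"
    unfolding separable_def by metis
  let ?F = "\<lambda>i. map_option (\<lambda>z. var z - h z) (Z i)"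
  have "coherently_separating Z ?F"
    unfolding coherently_separating_def
  proof (intro conjI exI[of _ "\<lambda>i. h (the (Z i))"] ballI)
    show "dom ?F = dom Z" by (auto simp: dom_def)
  next
    fix i assume "i \<in> dom Z"
    then show "the (?F i) = var (the (Z i)) - h (the (Z i))" by auto
  next
    fix i j t
    assume "i \<in> dom Z" "j \<in> dom Z" "t \<in> Poly_Mapping.keys (h (the (Z j)))"
    then show "\<not> var_dvd (the (Z i)) t"
      using h[of "the (Z j)"] by (auto simp: free_of_def ranI)
  qed
  moreover have "ran ?F \<subseteq> J"
    using h by (auto simp: ran_def)
  ultimately show "\<exists>F. coherently_separating_for J Z F"
    unfolding coherently_separating_for_def by blast
qed

section \<open>Linear parts, the dimension bound and best tuples as sets\<close>

interpretation scale: vector_space "scale :: 'k::field \<Rightarrow> ('n, 'k) mpoly \<Rightarrow> ('n, 'k) mpoly"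
  by (rule vector_space_scale)

lemma lookup_scale: "Poly_Mapping.lookup (scale c f) t = c * Poly_Mapping.lookup f t"
  unfolding scale_def mult_map_scale_conv_mult[symmetric] by (simp add: map.rep_eq when_def)

text \<open>The terms of standard degree 1 are the indeterminates. As these are finitely many,
  \<open>Lin J\<close> is finite-dimensional.\<close>

lemma linear_part_in_span_vars:
  fixes f :: "('n::finite, 'k::field) mpoly"
  shows "linear_part f \<in> scale.span (range var)"
proof -
  have eq: "linear_part f = (\<Sum>x\<in>UNIV. scale (Poly_Mapping.lookup f (var_term x)) (var x))"
  proof (rule poly_mapping_eqI)
    fix t
    show "Poly_Mapping.lookup (linear_part f) t =
        Poly_Mapping.lookup (\<Sum>x\<in>UNIV. scale (Poly_Mapping.lookup f (var_term x)) (var x)) t"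
    proof (cases "wdeg (\<lambda>_. 1) t = 1")
      case True
      then obtain y where "t = var_term y" by (rule standard_degree_one)
      then show ?thesis
        by (simp add: linear_part_def lookup_hom_component lookup_sum lookup_scale var_def
            lookup_single when_def if_distrib[of "(*) _"] cong: if_cong)
    next
      case False
      then have "t \<noteq> var_term x" "var_term x \<noteq> t" for x by auto
      with False show ?thesis
        by (simp add: linear_part_def lookup_hom_component lookup_sum lookup_scale var_def
            lookup_single)
    qed
  qed
  show ?thesis
    unfolding eq by (intro scale.span_sum scale.span_scale scale.span_base) auto
qed

text \<open>The linear parts of the polynomials \<open>z - h\<^sub>z\<close> are linearly independent, because each
  \<open>z \<in> A\<close> occurs in exactly one of them.\<close>

lemma card_separable_le_dim_Lin:
  fixes J :: "('n::finite, 'k::field) mpoly set"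
  assumes "separable J A"
  shows "card A \<le> scale.dim (Lin J)"
proof -
  obtain h where h: "\<And>z. z \<in> A \<Longrightarrow> var z - h z \<in> J \<and> free_of A (h z)"
    using assms unfolding separable_def by metis
  define l where "l z = linear_part (var z - h z)" for z
  have l: "Poly_Mapping.lookup (l z) (var_term x) = (if x = z then 1 else 0)" if "z \<in> A" "x \<in> A" for x z
  proof -
    have "Poly_Mapping.lookup (h z) (var_term x) = 0"
      using h[OF that(1)] that(2) by (metis free_of_def in_keys_iff var_dvd_var_term)
    then show ?thesis
      by (simp add: l_def linear_part_def lookup_hom_component lookup_minus var_def lookup_single when_def)
  qed
  have inj: "inj_on l A"
    by (rule inj_onI) (metis l zero_neq_one)
  have indep: "scale.independent (l ` A)"
  proof (rule scale.independent_if_scalars_zero)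
    fix c f
    assume sum0: "(\<Sum>v\<in>l ` A. scale (c v) v) = 0" and "f \<in> l ` A"
    then obtain z where z: "z \<in> A" "f = l z" by blast
    \<comment> \<open>Comparing coefficients at the indeterminate \<open>z\<close> isolates the
      scalar of \<open>l z\<close>.\<close>
    have "0 = Poly_Mapping.lookup (\<Sum>x\<in>A. scale (c (l x)) (l x)) (var_term z)"
      using sum0 inj by (simp add: sum.reindex)
    also have "\<dots> = (\<Sum>x\<in>A. if z = x then c (l x) else 0)"
      unfolding lookup_sum by (rule sum.cong) (auto simp: lookup_scale l z)
    also have "\<dots> = c f" using z by simp
    finally show "c f = 0" by simp
  qed simp
  have "l ` A \<subseteq> Lin J"
    using h by (auto simp: l_def Lin_def intro!: scale.span_base)
  then obtain B where B: "l ` A \<subseteq> B" "B \<subseteq> Lin J" "scale.independent B" "Lin J \<subseteq> scale.span B"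
    using indep by (rule scale.maximal_independent_subset_extend)
  \<comment> \<open>The basis \<open>B\<close> must be shown finite before cardinalities are
    compared, as \<open>card\<close> is 0 on infinite sets.\<close>
  have "linear_part ` J \<subseteq> scale.span (range var)"
    using linear_part_in_span_vars by blast
  then have "Lin J \<subseteq> scale.span (range var)"
    unfolding Lin_def by (rule scale.span_minimal) (rule scale.subspace_span)
  then have "finite B"
    using scale.independent_span_bound[of "range var" B] B by auto
  then have "card (l ` A) \<le> card B" using B(1) by (rule card_mono)
  then show ?thesis
    using scale.basis_card_eq_dim[OF B(2,4,3)] inj by (simp add: card_image)
qed

text \<open>Finiteness follows from distinct entries in a finite set of indeterminates, and the
  dimension bound from \<open>card_separable_le_dim_Lin\<close>.\<close>

lemma admissible_tuple_iff:
  fixes J :: "('n::finite, 'k::field) mpoly set"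
  shows "admissible_tuple J Z \<longleftrightarrow> distinct_entries Z \<and> separable J (ran Z)"
  unfolding admissible_tuple_def ex_coherently_separating_for_iff
  using card_separable_le_dim_Lin[of J "ran Z"] card_dom_eq_card_ran[of Z] finite_dom_of_distinct[of Z]
  by auto

text \<open>Every set of indeterminates is the range of a tuple with distinct entries, so maximality
  among tuples is maximality among sets.\<close>

lemma best_tuple_iff:
  fixes J :: "('n::finite, 'k::field) mpoly set"
  shows "best_tuple J Z \<longleftrightarrow> distinct_entries Z \<and> separable J (ran Z) \<and>
    (\<forall>A. separable J A \<longrightarrow> card A \<le> card (ran Z))"
proof -
  have "(\<forall>Z'. distinct_entries Z' \<and> separable J (ran Z') \<longrightarrow> card (ran Z') \<le> k) \<longleftrightarrow>
      (\<forall>A. separable J A \<longrightarrow> card A \<le> k)" for k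
    by (metis distinct_tuple_of_set)
  then show ?thesis
    unfolding best_tuple_def admissible_tuple_iff by (metis card_dom_eq_card_ran)
qed

subsection \<open>Reduction modulo a coherently separating set\<close>

text \<open>Induction on the standard degree: each indeterminate of \<open>L\<close> dividing
  \<open>t\<close> is replaced by its remainder. The remainders are free of \<open>A\<close> and so
  are their products, so nothing has to be reduced twice.\<close>

lemma reduce_term:
  fixes J :: "('n::finite, 'k::comm_ring_1) mpoly set"
  assumes ideal_J: "ideal_gen J = J"
    and sep: "\<And>z. z \<in> L \<Longrightarrow> \<exists>q. var z - q \<in> J \<and> free_of A q"
    and t: "\<And>x. x \<in> A \<Longrightarrow> var_dvd x t \<Longrightarrow> x \<in> L"
  shows "\<exists>q. Poly_Mapping.single t c - q \<in> J \<and> free_of A q"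
  using t
proof (induction "nat (wdeg (\<lambda>_. 1) t)" arbitrary: t rule: less_induct)
  case less
  show ?case
  proof (cases "t = 0")
    case True
    have "0 \<in> J" using ideal.span_zero ideal_J by blast
    then show ?thesis
      using True by (intro exI[of _ "Poly_Mapping.single t c"]) (auto simp: free_of_def)
  next
    case False
    then obtain x where "var_dvd x t"
      unfolding var_dvd_iff by (metis poly_mapping_eqI lookup_zero)
    then obtain u where u: "t = var_term x + u" by (auto simp: var_dvd_def)
    have "0 \<le> wdeg (\<lambda>_. 1) u" by (rule wdeg_nonneg) simp
    then have "nat (wdeg (\<lambda>_. 1) u) < nat (wdeg (\<lambda>_. 1) t)"
      by (simp add: u wdeg_add)
    moreover have "y \<in> L" if "y \<in> A" "var_dvd y u" for y
      using less.prems that by (simp add: u var_dvd_add)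
    ultimately obtain q where q: "Poly_Mapping.single u c - q \<in> J" "free_of A q"
      using less.hyps by blast
    \<comment> \<open>An indeterminate outside \<open>L\<close> is kept as it stands; by the
      assumption on \<open>t\<close> it is not in \<open>A\<close>.\<close>
    obtain p where p: "var x - p \<in> J" "free_of A p"
    proof (cases "x \<in> L")
      case True
      then show thesis using sep that by blast
    next
      case False
      then have "x \<notin> A" using less.prems[of x] u by (auto simp: var_dvd_def)
      then have "free_of A (var x :: ('n, 'k) mpoly)" by (auto simp: free_of_def)
      moreover have "0 \<in> J" using ideal.span_zero ideal_J by blast
      ultimately show thesis using that[of "var x"] by simp
    qed
    \<comment> \<open>This telescopes to the difference between the monomial at \<open>t\<close> and
      \<open>p * q\<close>.\<close>
    have "Poly_Mapping.single u c * (var x - p) + p * (Poly_Mapping.single u c - q) \<in> ideal_gen J"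
      using p q by (intro ideal.span_add ideal_gen_mult_left ideal.span_base)
    moreover have "Poly_Mapping.single t c = var x * Poly_Mapping.single u c"
      by (simp add: u var_def mult_single)
    then have "Poly_Mapping.single t c - p * q =
        Poly_Mapping.single u c * (var x - p) + p * (Poly_Mapping.single u c - q)"
      by (simp add: algebra_simps)
    ultimately have "Poly_Mapping.single t c - p * q \<in> J"
      using ideal_J by simp
    then show ?thesis
      using free_of_times[OF p(2) q(2)] by blast
  qed
qed

text \<open>The assumption on \<open>p\<close> says that it involves no indeterminate of
  \<open>A\<close> outside \<open>L\<close>, so \<open>reduce_term\<close> applies to each of its
  monomials.\<close>

lemma reduce_poly:
  fixes J :: "('n::finite, 'k::comm_ring_1) mpoly set"
  assumes ideal_J: "ideal_gen J = J"
    and sep: "\<And>z. z \<in> L \<Longrightarrow> \<exists>q. var z - q \<in> J \<and> free_of A q"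
    and "free_of (A - L) p"
  shows "\<exists>q. p - q \<in> J \<and> free_of A q"
proof -
  have "\<exists>q. Poly_Mapping.single t c - q \<in> J \<and> free_of A q" if "t \<in> Poly_Mapping.keys p" for t c
  proof (rule reduce_term[where L = L, OF ideal_J])
    show "\<exists>q. var z - q \<in> J \<and> free_of A q" if "z \<in> L" for z
      using that by (rule sep)
    show "x \<in> L" if "x \<in> A" "var_dvd x t" for x
      using assms(3) \<open>t \<in> Poly_Mapping.keys p\<close> that by (auto simp: free_of_def)
  qed
  then have "\<forall>t\<in>Poly_Mapping.keys p. \<exists>q.
      Poly_Mapping.single t (Poly_Mapping.lookup p t) - q \<in> J \<and> free_of A q"
    by blast
  from bchoice[OF this] obtain q where q: "\<And>t. t \<in> Poly_Mapping.keys p \<Longrightarrow>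
      Poly_Mapping.single t (Poly_Mapping.lookup p t) - q t \<in> J \<and> free_of A (q t)"
    by blast
  have "(\<Sum>t\<in>Poly_Mapping.keys p. Poly_Mapping.single t (Poly_Mapping.lookup p t) - q t) \<in> ideal_gen J"
    using q by (intro ideal.span_sum ideal.span_base) blast
  then have "p - (\<Sum>t\<in>Poly_Mapping.keys p. q t) \<in> J"
    by (simp add: ideal_J sum_subtractf flip: poly_mapping_expand)
  \<comment> \<open>Generalised to subsets \<open>T\<close> for the induction, since
    \<open>q\<close> is controlled only on the support of \<open>p\<close>.\<close>
  moreover have "free_of A (\<Sum>t\<in>T. q t)" if "T \<subseteq> Poly_Mapping.keys p" for T
    using that by (induction T rule: infinite_finite_induct) (auto simp: q free_of_add, auto simp: free_of_def)
  ultimately show ?thesis by blast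
qed

section \<open>Separable sets degree by degree\<close>

text \<open>Forward, the remainder of \<open>hom_component_split\<close> is absorbed into the new
  \<open>h\<close>, as it involves no indeterminate of degree \<open>d\<close>. Backward, induction
  on \<open>W z\<close> supplies the polynomials for the indeterminates of smaller degree.\<close>

lemma separable_iff_graded:
  fixes S :: "('n::finite, 'k::comm_ring_1) mpoly set"
  assumes nonneg: "\<And>x. 0 \<le> W x"
    and hom: "\<And>g. g \<in> S \<Longrightarrow> \<exists>e\<ge>1. homogeneous W e g"
  shows "separable (ideal_gen S) A \<longleftrightarrow> (\<forall>z\<in>A. 1 \<le> W z) \<and>
    (\<forall>d\<ge>1. separable (ideal_gen {g \<in> S. homogeneous W d g}) {z \<in> A. W z = d})"
    (is "_ \<longleftrightarrow> _ \<and> (\<forall>d\<ge>1. separable (?I d) (?A d))")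
proof (intro iffI conjI ballI allI impI)
  fix z assume sep: "separable (ideal_gen S) A" and z: "z \<in> A"
  then obtain h where h: "var z - h \<in> ideal_gen S" "free_of A h"
    unfolding separable_def by blast
  show "1 \<le> W z"
    using wdeg_ge_of_ideal_gen[of W S, OF nonneg hom h(1)] var_term_in_keys_var_minus[OF h(2) z, of z]
    by force
next
  fix d :: int
  assume sep: "separable (ideal_gen S) A" and "1 \<le> d"
  show "separable (?I d) (?A d)"
    unfolding separable_def
  proof
    fix z assume z: "z \<in> ?A d"
    then obtain h where h: "var z - h \<in> ideal_gen S" "free_of A h"
      using sep unfolding separable_def by blast
    obtain r where r: "hom_component W d (var z - h) - r \<in> ?I d"
        "\<And>t x. t \<in> Poly_Mapping.keys r \<Longrightarrow> var_dvd x t \<Longrightarrow> W x < d"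
      using hom_component_split[of W S, OF nonneg hom h(1)] by blast
    have "hom_component W d (var z :: ('n, 'k) mpoly) = var z"
      using z hom_component_homogeneous[OF homogeneous_var[of W z], of d] by simp
    then have "var z - (hom_component W d h + r) \<in> ?I d"
      using r(1) by (simp add: hom_component_minus algebra_simps)
    moreover have "free_of (?A d) (hom_component W d h)"
      using h(2) by (auto simp: free_of_def keys_hom_component)
    moreover have "free_of (?A d) r"
      unfolding free_of_def using r(2) by fastforce
    ultimately show "\<exists>h. var z - h \<in> ?I d \<and> free_of (?A d) h"
      using free_of_add by blast
  qed
next
  assume R: "(\<forall>z\<in>A. 1 \<le> W z) \<and> (\<forall>d\<ge>1. separable (?I d) (?A d))"
  have "\<exists>q. var z - q \<in> ideal_gen S \<and> free_of A q" if "z \<in> A" for z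
    using that
  proof (induction "nat (W z)" arbitrary: z rule: less_induct)
    case less
    define d where "d = W z"
    have d: "1 \<le> d" using R less.prems by (simp add: d_def)
    then have "separable (?I d) (?A d)" using R by blast
    then obtain h where h: "var z - h \<in> ?I d" "free_of (?A d) h"
      unfolding separable_def using less.prems d_def by blast
    have "?I d \<subseteq> ideal_gen S" by (rule ideal.span_mono) auto
    then have "hom_component W d (var z - h) \<in> ideal_gen {g \<in> S. \<exists>e\<in>{1..d}. homogeneous W e g}"
      using h(1) by (intro hom_component_in_ideal_gen[of W S, OF nonneg hom]) auto
    also have "\<dots> \<subseteq> ideal_gen S" by (rule ideal.span_mono) auto
    finally have comp: "hom_component W d (var z - h) \<in> ideal_gen S" .
    have "hom_component W d (var z :: ('n, 'k) mpoly) = var z"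
      using hom_component_homogeneous[OF homogeneous_var[of W z], of d] by (simp add: d_def)
    then have z: "var z - hom_component W d h \<in> ideal_gen S"
      using comp by (simp add: hom_component_minus)
    \<comment> \<open>An indeterminate of degree above \<open>d\<close> divides no term of degree
      \<open>d\<close>, and those of degree \<open>d\<close> in \<open>A\<close> are excluded by
      \<open>h\<close>. Only \<open>?L\<close> remains to be eliminated.\<close>
    let ?L = "{x \<in> A. W x < d}"
    have "\<exists>q. hom_component W d h - q \<in> ideal_gen S \<and> free_of A q"
    proof (rule reduce_poly[where L = ?L])
      show "ideal_gen (ideal_gen S) = ideal_gen S" by (rule ideal.span_span)
      show "\<exists>q. var x - q \<in> ideal_gen S \<and> free_of A q" if "x \<in> ?L" for x
        using that d by (intro less.hyps) (auto simp: d_def)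
      show "free_of (A - ?L) (hom_component W d h)"
        unfolding free_of_def
      proof (intro ballI notI)
        fix t x
        assume t: "t \<in> Poly_Mapping.keys (hom_component W d h)" and x: "x \<in> A - ?L" "var_dvd x t"
        then have "W x \<le> d"
          using wdeg_ge_var[of W x t, OF nonneg] by (simp add: keys_hom_component)
        then have "x \<in> ?A d" using x by auto
        then show False using h(2) t x(2) by (auto simp: free_of_def keys_hom_component)
      qed
    qed
    then obtain q where q: "hom_component W d h - q \<in> ideal_gen S" "free_of A q" by blast
    have "var z - q = (var z - hom_component W d h) + (hom_component W d h - q)" by simp
    then have "var z - q \<in> ideal_gen S"
      using z q(1) ideal.span_add by metis
    then show ?case using q(2) by blast
  qed
  then show "separable (ideal_gen S) A" unfolding separable_def by blast
qed

text \<open>Each \<open>z\<close> is a term of its own polynomial \<open>var z - h\<close>. Hence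
  every competitor of \<open>Z_d\<close> for I_d consists of indeterminates of degree
  \<open>d\<close>.\<close>

lemma separable_deg_ideal:
  fixes S :: "('n::finite, 'k::comm_ring_1) mpoly set"
  assumes "d \<noteq> 0" "separable (ideal_gen {g \<in> S. homogeneous W d g}) A" "z \<in> A"
  shows "W z = d"
proof -
  obtain h where h: "var z - h \<in> ideal_gen {g \<in> S. homogeneous W d g}" "free_of A h"
    using assms(2,3) unfolding separable_def by blast
  show ?thesis
    using var_term_in_keys_ideal_gen[OF _ assms(1) h(1)] var_term_in_keys_var_minus[OF h(2) assms(3), of z]
    by simp
qed

text \<open>The index set \<open>range W\<close> is the same for all \<open>A\<close>, so that two
  such sums can be compared termwise.\<close>

lemma card_eq_sum_degrees:
  fixes A :: "'n::finite set"
  shows "card A = (\<Sum>d\<in>range W. card {z \<in> A. W z = d})"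
proof -
  have "W ` A \<subseteq> range W" by blast
  then show ?thesis
    using sum.group[of A "range W" W "\<lambda>_. 1::nat"] by simp
qed

subsection \<open>Subtuples\<close>

lemma subtuple_eq_Some: "subtuple P S i = Some a \<longleftrightarrow> S i = Some a \<and> P a"
  by (auto simp: subtuple_def restrict_map_def)

lemma ran_subtuple: "ran (subtuple P S) = {a \<in> ran S. P a}"
  by (auto simp: ran_def subtuple_eq_Some)

lemma dom_subtuple: "dom (subtuple P S) = {i. \<exists>a. S i = Some a \<and> P a}"
  by (auto simp: dom_def subtuple_eq_Some)

lemma distinct_entries_subtuple: "distinct_entries S \<Longrightarrow> distinct_entries (subtuple P S)"
  unfolding distinct_entries_def
proof (rule inj_onI)
  fix i j
  assume inj: "inj_on S (dom S)" and ij: "i \<in> dom (subtuple P S)" "j \<in> dom (subtuple P S)"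
    and eq: "subtuple P S i = subtuple P S j"
  obtain a where "subtuple P S i = Some a" using ij by blast
  with eq have "S i = Some a" "S j = Some a"
    by (metis subtuple_eq_Some)+
  then show "i = j" using inj_onD[OF inj, of i j] by (simp add: domI)
qed

lemma ran_deg_polys: "ran (deg_polys W d F) = {f \<in> ran F. homogeneous W d f}"
  by (simp add: deg_polys_def ran_subtuple)

lemma ran_deg_vars: "ran (deg_vars W d Z) = {z \<in> ran Z. W z = d}"
  by (simp add: deg_vars_def ran_subtuple)

lemma deg_ideal_eq: "deg_ideal W d G = ideal_gen {g \<in> ran G. homogeneous W d g}"
  by (simp add: deg_ideal_def ran_deg_polys)

lemma deg_le_ideal_eq:
  "deg_le_ideal W d G = ideal_gen {g \<in> ran G. \<exists>e\<in>{1..d}. homogeneous W e g}"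
  unfolding deg_le_ideal_def ran_deg_polys by (rule arg_cong[where f = ideal_gen]) auto

section \<open>Best tuples degree by degree\<close>

lemma best_tuple_iff_graded:
  fixes G :: "('n::finite, 'k::field) mpoly tuple" and Z :: "'n tuple"
  assumes nonneg: "\<And>x. 0 \<le> W x"
    and hom: "\<And>g. g \<in> ran G \<Longrightarrow> \<exists>d\<ge>1. homogeneous W d g"
    and Z: "distinct_entries Z"
  shows "best_tuple (ideal_gen (ran G)) Z \<longleftrightarrow>
    (\<forall>z\<in>ran Z. 1 \<le> W z) \<and> (\<forall>d\<ge>1. best_tuple (deg_ideal W d G) (deg_vars W d Z))"
proof -
  let ?I = "ideal_gen (ran G)" and ?D = "\<lambda>d. deg_ideal W d G"
  have Zd: "distinct_entries (deg_vars W d Z)" for d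
    using Z unfolding deg_vars_def by (rule distinct_entries_subtuple)
  have sep: "separable ?I A \<longleftrightarrow> (\<forall>z\<in>A. 1 \<le> W z) \<and> (\<forall>d\<ge>1. separable (?D d) {z \<in> A. W z = d})" for A
    unfolding deg_ideal_eq by (rule separable_iff_graded[OF nonneg hom])
  have deg: "W z = d" if "1 \<le> d" "separable (?D d) A" "z \<in> A" for d A z
    using that separable_deg_ideal[where S = "ran G"] unfolding deg_ideal_eq by fastforce
  show ?thesis
    unfolding best_tuple_iff ran_deg_vars
  proof (intro iffI conjI ballI allI impI Z Zd; (elim conjE)?)
    assume "separable ?I (ran Z)"
    then show "1 \<le> W z" if "z \<in> ran Z" for z using sep that by blast
    show "separable (?D d) {z \<in> ran Z. W z = d}" if "1 \<le> d" for d
      using \<open>separable ?I (ran Z)\<close> sep that by blast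
  next
    fix d A
    assume sepZ: "separable ?I (ran Z)" and max: "\<forall>A. separable ?I A \<longrightarrow> card A \<le> card (ran Z)"
      and d: "1 \<le> d" and A: "separable (?D d) A"
    let ?Zd = "{z \<in> ran Z. W z = d}"
    \<comment> \<open>Exchange argument: \<open>A\<close> lies entirely in degree \<open>d\<close>,
      so replacing \<open>?Zd\<close> by it leaves all other degrees unchanged, and a larger
      \<open>A\<close> would give a larger separable set for \<open>?I\<close>.\<close>
    let ?B = "(ran Z - ?Zd) \<union> A"
    have B: "{z \<in> ?B. W z = e} = (if e = d then A else {z \<in> ran Z. W z = e})" for e
      using deg[OF d A] by auto
    have "separable ?I ?B"
      unfolding sep
    proof (intro conjI ballI allI impI)
      show "1 \<le> W z" if "z \<in> ?B" for z
        using that sepZ d deg[OF d A] sep by auto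
      show "separable (?D e) {z \<in> ?B. W z = e}" if "1 \<le> e" for e
        unfolding B using that A sepZ sep by auto
    qed
    then have "card ?B \<le> card (ran Z)" using max by blast
    moreover have "card ?B = card (ran Z - ?Zd) + card A"
      using deg[OF d A] by (intro card_Un_disjoint) auto
    moreover have "card (ran Z - ?Zd) + card ?Zd = card (ran Z)"
      by (simp add: card_Diff_subset card_mono)
    ultimately show "card A \<le> card ?Zd" by linarith
  next
    assume R: "\<forall>z\<in>ran Z. 1 \<le> W z"
      "\<forall>d\<ge>1. distinct_entries (deg_vars W d Z) \<and> separable (?D d) {z \<in> ran Z. W z = d} \<and>
        (\<forall>A. separable (?D d) A \<longrightarrow> card A \<le> card {z \<in> ran Z. W z = d})"
    then show "separable ?I (ran Z)" using sep by blast
    fix A assume A: "separable ?I A"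
    have "card {z \<in> A. W z = d} \<le> card {z \<in> ran Z. W z = d}" for d
    proof (cases "1 \<le> d")
      case True
      then show ?thesis using R(2) A sep by blast
    next
      \<comment> \<open>\<open>range W\<close> may contain 0, where no maximality is assumed;
        separability of \<open>A\<close> makes this part empty.\<close>
      case False
      then have "{z \<in> A. W z = d} = {}" using A sep by auto
      then show ?thesis by (simp only: card.empty)
    qed
    then show "card A \<le> card (ran Z)"
      unfolding card_eq_sum_degrees[of A W] card_eq_sum_degrees[of "ran Z" W] by (intro sum_mono)
  qed
qed

text \<open>A homogeneous polynomial of degree \<open>d\<close> is its own component of degree
  \<open>d\<close>.\<close>

lemma deg_polys_subset_deg_le_ideal:
  fixes G :: "('n::finite, 'k::comm_ring_1) mpoly tuple"
  assumes nonneg: "\<And>x. 0 \<le> W x"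
    and hom: "\<And>g. g \<in> ran G \<Longrightarrow> \<exists>d\<ge>1. homogeneous W d g"
    and F: "ran F \<subseteq> ideal_gen (ran G)"
  shows "ran (deg_polys W d F) \<subseteq> deg_le_ideal W d G"
proof
  fix f assume "f \<in> ran (deg_polys W d F)"
  then have f: "f \<in> ideal_gen (ran G)" "homogeneous W d f"
    using F by (auto simp: ran_deg_polys)
  then show "f \<in> deg_le_ideal W d G"
    using hom_component_in_ideal_gen[of W "ran G", OF nonneg hom f(1), of d]
    by (simp add: hom_component_homogeneous deg_le_ideal_eq)
qed

subsection \<open>Gluing term orderings\<close>

text \<open>Here \<open>d\<close> is the weight of the indeterminates that are kept, not the degree
  of the resulting term. Every term is the product of these factors.\<close>

lift_definition restrict_deg :: "('n::finite \<Rightarrow> int) \<Rightarrow> int \<Rightarrow> 'n pterm \<Rightarrow> 'n pterm"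
  is "\<lambda>W d t x. if W x = d then t x else 0"
  by simp

lemma restrict_deg_zero [simp]: "restrict_deg W d 0 = 0"
  by transfer auto

lemma restrict_deg_add: "restrict_deg W d (s + t) = restrict_deg W d s + restrict_deg W d t"
  by transfer auto

lemma restrict_deg_eqI:
  assumes "\<And>d. restrict_deg W d s = restrict_deg W d t"
  shows "s = t"
proof (rule poly_mapping_eqI)
  fix x
  show "Poly_Mapping.lookup s x = Poly_Mapping.lookup t x"
    using arg_cong[OF assms[of "W x"], of "\<lambda>u. Poly_Mapping.lookup u x"]
    by (simp add: restrict_deg.rep_eq)
qed

lemma restrict_deg_var_term: "restrict_deg W d (var_term x) = (if W x = d then var_term x else 0)"
  unfolding var_term_def
  by (rule poly_mapping_eqI) (auto simp: restrict_deg.rep_eq lookup_single when_def)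

text \<open>The witness \<open>d\<close> is the largest weight at which the terms differ; equal
  terms have no such weight and form a separate case.\<close>

definition block_ordering ::
    "('n::finite \<Rightarrow> int) \<Rightarrow> (int \<Rightarrow> 'n pterm rel) \<Rightarrow> 'n pterm rel" where
  "block_ordering W \<sigma> = {(s, t). s = t \<or> (\<exists>d. (\<forall>e>d. restrict_deg W e s = restrict_deg W e t) \<and>
     restrict_deg W d s \<noteq> restrict_deg W d t \<and> (restrict_deg W d s, restrict_deg W d t) \<in> \<sigma> d)}"

lemma block_orderingI:
  assumes "\<And>e. e > d \<Longrightarrow> restrict_deg W e s = restrict_deg W e t"
    and "restrict_deg W d s \<noteq> restrict_deg W d t"
    and "(restrict_deg W d s, restrict_deg W d t) \<in> \<sigma> d"
  shows "(s, t) \<in> block_ordering W \<sigma>"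
  using assms unfolding block_ordering_def by blast

lemma block_ordering_cases:
  assumes "(s, t) \<in> block_ordering W \<sigma>" "s \<noteq> t"
  obtains d where "\<forall>e>d. restrict_deg W e s = restrict_deg W e t"
    "restrict_deg W d s \<noteq> restrict_deg W d t" "(restrict_deg W d s, restrict_deg W d t) \<in> \<sigma> d"
  using assms unfolding block_ordering_def by blast

text \<open>Restricting to a value that is not a weight gives the term 1, so differences occur only
  in the finite set \<open>range W\<close>.\<close>

lemma last_difference:
  fixes s t :: "'n::finite pterm"
  assumes "s \<noteq> t"
  obtains d where "\<forall>e>d. restrict_deg W e s = restrict_deg W e t"
    "restrict_deg W d s \<noteq> restrict_deg W d t"
proof -
  let ?D = "{d. restrict_deg W d s \<noteq> restrict_deg W d t}"
  have "?D \<subseteq> range W"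
  proof (rule ccontr)
    assume "\<not> ?D \<subseteq> range W"
    then obtain d where d: "restrict_deg W d s \<noteq> restrict_deg W d t" "d \<notin> range W" by blast
    have "restrict_deg W d s = restrict_deg W d t"
      by (rule poly_mapping_eqI) (use d(2) in \<open>auto simp: restrict_deg.rep_eq\<close>)
    with d(1) show False ..
  qed
  then have fin: "finite ?D" by (rule finite_subset) simp
  have ne: "?D \<noteq> {}" using restrict_deg_eqI[of W s t] assms by auto
  have "restrict_deg W e s = restrict_deg W e t" if "e > Max ?D" for e
    using Max_ge[OF fin, of e] that by auto
  then show thesis using that Max_in[OF fin ne] by blast
qed

lemma term_orderingD:
  assumes "term_ordering \<sigma>"
  shows "(s, s) \<in> \<sigma>" "(s, t) \<in> \<sigma> \<Longrightarrow> (t, u) \<in> \<sigma> \<Longrightarrow> (s, u) \<in> \<sigma>"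
    "(s, t) \<in> \<sigma> \<Longrightarrow> (t, s) \<in> \<sigma> \<Longrightarrow> s = t" "(s, t) \<in> \<sigma> \<or> (t, s) \<in> \<sigma>"
    "(0, t) \<in> \<sigma>" "(s, t) \<in> \<sigma> \<Longrightarrow> (s + u, t + u) \<in> \<sigma>"
proof -
  have lin: "refl \<sigma>" "trans \<sigma>" "antisym \<sigma>" "total \<sigma>"
    using assms by (auto simp: term_ordering_def order_on_defs)
  show refl: "(s, s) \<in> \<sigma>" for s
    using lin(1) by (simp add: refl_on_def)
  show "(s, t) \<in> \<sigma> \<Longrightarrow> (t, u) \<in> \<sigma> \<Longrightarrow> (s, u) \<in> \<sigma>"
    using lin(2) by (rule transD)
  show "(s, t) \<in> \<sigma> \<Longrightarrow> (t, s) \<in> \<sigma> \<Longrightarrow> s = t"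
    using lin(3) by (rule antisymD)
  show "(s, t) \<in> \<sigma> \<or> (t, s) \<in> \<sigma>"
    using lin(4) refl by (cases "s = t") (auto simp: total_on_def)
  show "(0, t) \<in> \<sigma>" "(s, t) \<in> \<sigma> \<Longrightarrow> (s + u, t + u) \<in> \<sigma>"
    using assms by (auto simp: term_ordering_def)
qed

lemma term_ordering_block_ordering:
  assumes "\<And>d. term_ordering (\<sigma> d)"
  shows "term_ordering (block_ordering W \<sigma>)"
proof -
  note ord = term_orderingD[OF assms]
  let ?R = "block_ordering W \<sigma>" and ?r = "restrict_deg W"
  have refl: "(s, s) \<in> ?R" for s by (simp add: block_ordering_def)
  have tot: "(s, t) \<in> ?R \<or> (t, s) \<in> ?R" for s t
  proof (cases "s = t")
    case True
    then show ?thesis by (simp add: refl)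
  next
    case False
    then obtain d where d: "\<forall>e>d. ?r e s = ?r e t" "?r d s \<noteq> ?r d t"
      using last_difference by blast
    show ?thesis
      using term_orderingD(4)[OF assms, of "?r d s" "?r d t" d]
      by (metis d block_orderingI)
  qed
  have antisym: "s = t" if st: "(s, t) \<in> ?R" and ts: "(t, s) \<in> ?R" for s t
  proof (rule ccontr)
    assume "s \<noteq> t"
    obtain d where d: "\<forall>e>d. ?r e s = ?r e t" "?r d s \<noteq> ?r d t" "(?r d s, ?r d t) \<in> \<sigma> d"
      by (rule block_ordering_cases[OF st \<open>s \<noteq> t\<close>])
    obtain d' where d': "\<forall>e>d'. ?r e t = ?r e s" "?r d' t \<noteq> ?r d' s" "(?r d' t, ?r d' s) \<in> \<sigma> d'"
      by (rule block_ordering_cases[OF ts \<open>s \<noteq> t\<close>[symmetric]])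
    \<comment> \<open>Both are the largest weight at which \<open>s\<close> and \<open>t\<close>
      differ.\<close>
    have "d = d'" using d d' by (metis linorder_neqE)
    then show False using d d' ord(3) by blast
  qed
  have trans: "(s, u) \<in> ?R" if st: "(s, t) \<in> ?R" and tu: "(t, u) \<in> ?R" for s t u
  proof (cases "s = t \<or> t = u")
    case True
    then show ?thesis using st tu by auto
  next
    case False
    then have "s \<noteq> t" "t \<noteq> u" by auto
    obtain d where d: "\<forall>e>d. ?r e s = ?r e t" "?r d s \<noteq> ?r d t" "(?r d s, ?r d t) \<in> \<sigma> d"
      by (rule block_ordering_cases[OF st \<open>s \<noteq> t\<close>])
    obtain d' where d': "\<forall>e>d'. ?r e t = ?r e u" "?r d' t \<noteq> ?r d' u" "(?r d' t, ?r d' u) \<in> \<sigma> d'"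
      by (rule block_ordering_cases[OF tu \<open>t \<noteq> u\<close>])
    \<comment> \<open>The larger weight decides. If they agree, antisymmetry of
      \<open>\<sigma> d\<close> keeps the blocks of \<open>s\<close> and \<open>u\<close>
      distinct.\<close>
    consider "d < d'" | "d' < d" | "d = d'" by linarith
    then show ?thesis
    proof cases
      case 1
      then show ?thesis using d d' by (intro block_orderingI[where d = d']) auto
    next
      case 2
      then show ?thesis using d d' by (intro block_orderingI[where d = d]) auto
    next
      case 3
      have "(?r d s, ?r d u) \<in> \<sigma> d" using d(3) d'(3) 3 ord(2) by blast
      moreover have "?r d s \<noteq> ?r d u" using d d' 3 ord(3) by metis
      ultimately show ?thesis using d d' 3 by (intro block_orderingI[where d = d]) auto
    qed
  qed
  have zero: "(0, t) \<in> ?R" for t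
  proof (cases "t = 0")
    case False
    then obtain d where d: "\<forall>e>d. ?r e 0 = ?r e t" "?r d 0 \<noteq> ?r d t"
      using last_difference[of 0 t] by metis
    then show ?thesis by (intro block_orderingI[where d = d]) (auto simp: ord(5))
  qed (simp add: refl)
  have add: "(s + u, t + u) \<in> ?R" if st: "(s, t) \<in> ?R" for s t u
  proof (cases "s = t")
    case False
    obtain d where "\<forall>e>d. ?r e s = ?r e t" "?r d s \<noteq> ?r d t" "(?r d s, ?r d t) \<in> \<sigma> d"
      by (rule block_ordering_cases[OF st False])
    then show ?thesis
      by (intro block_orderingI[where d = d]) (auto simp: restrict_deg_add ord(6))
  qed (simp add: refl)
  show ?thesis
    unfolding term_ordering_def order_on_defs
  proof (intro conjI allI impI zero add)
    show "refl ?R" using refl by (simp add: refl_on_def)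
    show "trans ?R" using trans by (rule transI)
    show "antisym ?R" using antisym by (rule antisymI)
    show "total ?R" using tot by (simp add: total_on_def)
  qed simp_all
qed

text \<open>The part of \<open>t\<close> of degree \<open>W z\<close> divides \<open>t\<close>, so it is at most \<open>z\<close> for \<open>\<sigma> (W z)\<close>; if it
  equals \<open>z\<close>, then also \<open>t = z\<close>, as \<open>t\<close> lies between the two.\<close>

lemma block_ordering_le_var_term:
  fixes W :: "'n::finite \<Rightarrow> int"
  assumes nonneg: "\<And>x. 0 \<le> W x" and ord: "\<And>d. term_ordering (\<sigma> d)"
    and t: "wdeg W t = W z" and le: "(t, var_term z) \<in> \<sigma> (W z)"
  shows "(t, var_term z) \<in> block_ordering W \<sigma>"
proof -
  let ?d = "W z"
  note o = term_orderingD[OF ord[of ?d]]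
  \<comment> \<open>An indeterminate of weight \<open>e\<close> dividing \<open>t\<close> would
    force the degree of \<open>t\<close> to be at least \<open>e\<close>.\<close>
  have "restrict_deg W e t = 0" if "e > ?d" for e
  proof (rule poly_mapping_eqI)
    fix x
    show "Poly_Mapping.lookup (restrict_deg W e t) x = Poly_Mapping.lookup 0 x"
      using wdeg_ge_var[of W x t, OF nonneg] that t
      by (cases "var_dvd x t") (auto simp: restrict_deg.rep_eq var_dvd_iff)
  qed
  then have above: "restrict_deg W e t = restrict_deg W e (var_term z)" if "e > ?d" for e
    using that by (simp add: restrict_deg_var_term)
  have split: "t = restrict_deg W ?d t + (t - restrict_deg W ?d t)"
    by (rule poly_mapping_eqI) (auto simp: lookup_add lookup_minus restrict_deg.rep_eq)
  let ?u = "t - restrict_deg W ?d t"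
  have "(restrict_deg W ?d t, t) \<in> \<sigma> ?d"
    using o(6)[OF o(5)[of ?u], of "restrict_deg W ?d t"] split by (simp add: add.commute)
  then have le': "(restrict_deg W ?d t, var_term z) \<in> \<sigma> ?d" using le o(2) by blast
  show ?thesis
  proof (cases "restrict_deg W ?d t = var_term z")
    case True
    then have "(t, restrict_deg W ?d t) \<in> \<sigma> ?d" using le by simp
    then have "t = restrict_deg W ?d t" using \<open>(restrict_deg W ?d t, t) \<in> \<sigma> ?d\<close> o(3) by blast
    then show ?thesis using True by (simp add: block_ordering_def)
  next
    case False
    then show ?thesis
      using above le' by (intro block_orderingI[where d = ?d]) (auto simp: restrict_deg_var_term)
  qed
qed

subsection \<open>Separating tuples\<close>

text \<open>The zero polynomial belongs to all \<open>F\<^sub>d\<close>, but no indeterminate belongs to two \<open>Z\<^sub>d\<close>;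
  hence matching domains force all entries to be nonzero.\<close>

lemma entry_degree:
  fixes F :: "('n::finite, 'k::comm_ring_1) mpoly tuple"
  assumes dom: "\<And>d. 1 \<le> d \<Longrightarrow> dom (deg_polys W d F) = dom (deg_vars W d Z)"
    and hom: "\<exists>d. homogeneous W d f"
    and pos: "\<And>t. t \<in> Poly_Mapping.keys f \<Longrightarrow> 1 \<le> wdeg W t"
    and i: "F i = Some f" "Z i = Some z"
  shows "1 \<le> W z" "homogeneous W (W z) f"
proof -
  have *: "W z = d" if "1 \<le> d" "homogeneous W d f" for d
  proof -
    have "i \<in> dom (deg_polys W d F)"
      using that i by (simp add: deg_polys_def dom_subtuple)
    then have "i \<in> dom (deg_vars W d Z)" using dom[OF that(1)] by simp
    then show ?thesis using i by (simp add: deg_vars_def dom_subtuple)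
  qed
  \<comment> \<open>A zero entry would be homogeneous of degrees 1 and 2, forcing \<open>W z\<close>
    to equal both.\<close>
  have "f \<noteq> 0"
    using *[of 1] *[of 2] by (auto simp: homogeneous_def)
  then obtain t where t: "t \<in> Poly_Mapping.keys f"
    by (metis in_keys_iff lookup_zero poly_mapping_eqI)
  obtain d where d: "homogeneous W d f" using hom by blast
  then have "1 \<le> d" using pos[OF t] t by (auto simp: homogeneous_def)
  then show "1 \<le> W z" "homogeneous W (W z) f" using * d by auto
qed

text \<open>As \<open>z\<close> is a term of the homogeneous polynomial at its position, the degree
  of that polynomial can only be \<open>W z\<close>.\<close>

lemma dom_deg_polys_eq:
  fixes F :: "('n::finite, 'k::comm_ring_1) mpoly tuple"
  assumes dom: "dom F = dom Z"
    and hom: "\<And>f. f \<in> ran F \<Longrightarrow> \<exists>e. homogeneous W e f"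
    and var: "\<And>i f z. F i = Some f \<Longrightarrow> Z i = Some z \<Longrightarrow> var_term z \<in> Poly_Mapping.keys f"
  shows "dom (deg_polys W d F) = dom (deg_vars W d Z)"
proof -
  have *: "homogeneous W d f \<longleftrightarrow> W z = d" if "F i = Some f" "Z i = Some z" for i f z
    using var[OF that] hom[OF ranI[of F, OF that(1)]] unfolding homogeneous_def
    by (metis wdeg_var_term)
  show ?thesis
    unfolding deg_polys_def deg_vars_def dom_subtuple
  proof (intro Collect_cong iffI; elim exE conjE)
    fix i f assume f: "F i = Some f" "homogeneous W d f"
    then obtain z where "Z i = Some z" using dom by blast
    with * f show "\<exists>z. Z i = Some z \<and> W z = d" by blast
  next
    fix i z assume z: "Z i = Some z" "W z = d"
    then obtain f where "F i = Some f" using dom by blast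
    with * z show "\<exists>f. F i = Some f \<and> homogeneous W d f" by blast
  qed
qed

lemma separating_iff_graded:
  fixes F :: "('n::finite, 'k::comm_ring_1) mpoly tuple"
  assumes nonneg: "\<And>x. 0 \<le> W x"
    and dom: "dom F = dom Z"
    and hom: "\<And>f. f \<in> ran F \<Longrightarrow> \<exists>d. homogeneous W d f"
    and pos: "\<And>f t. f \<in> ran F \<Longrightarrow> t \<in> Poly_Mapping.keys f \<Longrightarrow> 1 \<le> wdeg W t"
  shows "separating Z F \<longleftrightarrow> (\<forall>d\<ge>1. separating (deg_vars W d Z) (deg_polys W d F))"
proof
  assume "separating Z F"
  then obtain \<sigma> where \<sigma>: "term_ordering \<sigma>"
      "\<And>i. i \<in> dom Z \<Longrightarrow> is_LT \<sigma> (the (F i)) (var_term (the (Z i)))"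
    unfolding separating_def by blast
  have "var_term z \<in> Poly_Mapping.keys f" if "F i = Some f" "Z i = Some z" for i f z
    using \<sigma>(2)[of i] that by (auto simp: is_LT_def)
  then have dom_d: "dom (deg_polys W d F) = dom (deg_vars W d Z)" for d
    using dom_deg_polys_eq[OF dom hom] by blast
  show "\<forall>d\<ge>1. separating (deg_vars W d Z) (deg_polys W d F)"
    unfolding separating_def
  proof (intro allI impI conjI exI[of _ \<sigma>] ballI)
    fix d i assume i: "i \<in> dom (deg_vars W d Z)"
    then obtain z where z: "deg_vars W d Z i = Some z" by blast
    from i obtain f where f: "deg_polys W d F i = Some f" using dom_d by blast
    show "is_LT \<sigma> (the (deg_polys W d F i)) (var_term (the (deg_vars W d Z i)))"
    proof -
      have "Z i = Some z" "F i = Some f"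
        using z f by (simp_all add: deg_vars_def deg_polys_def subtuple_eq_Some)
      then show ?thesis using z f \<sigma>(2)[of i] by (simp add: domI)
    qed
  qed (simp_all add: \<sigma>(1) dom_d)
next
  assume R: "\<forall>d\<ge>1. separating (deg_vars W d Z) (deg_polys W d F)"
  then have dom_d: "dom (deg_polys W d F) = dom (deg_vars W d Z)" if "1 \<le> d" for d
    using that by (simp add: separating_def)
  obtain \<sigma> where \<sigma>: "\<And>d. 1 \<le> d \<Longrightarrow> term_ordering (\<sigma> d)"
      "\<And>d i. 1 \<le> d \<Longrightarrow> i \<in> dom (deg_vars W d Z) \<Longrightarrow>
        is_LT (\<sigma> d) (the (deg_polys W d F i)) (var_term (the (deg_vars W d Z i)))"
    using R unfolding separating_def by metis
  \<comment> \<open>Gluing asks for a term ordering at every integer, while \<open>\<sigma>\<close>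
    is known only from 1 on; \<open>\<sigma> 1\<close> fills the other places.\<close>
  define \<tau> where "\<tau> d = (if 1 \<le> d then \<sigma> d else \<sigma> 1)" for d
  have \<tau>: "term_ordering (\<tau> d)" for d
    by (simp add: \<tau>_def \<sigma>(1))
  have LT: "is_LT (block_ordering W \<tau>) (the (F i)) (var_term (the (Z i)))" if i: "i \<in> dom Z" for i
  proof -
    obtain z where z: "Z i = Some z" using i by blast
    obtain f where f: "F i = Some f" using i dom by blast
    then have fran: "f \<in> ran F" by (rule ranI)
    have d: "1 \<le> W z" "homogeneous W (W z) f"
      using entry_degree[OF dom_d hom[OF fran] pos[OF fran] f z] by auto
    have fd: "deg_polys W (W z) F i = Some f" and zd: "deg_vars W (W z) Z i = Some z"
      using f z d by (auto simp: deg_polys_def deg_vars_def subtuple_eq_Some)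
    then have "is_LT (\<tau> (W z)) f (var_term z)"
      using \<sigma>(2)[OF d(1), of i] d(1) by (auto simp: \<tau>_def)
    then show ?thesis
      using d(2) f z block_ordering_le_var_term[of W \<tau>, OF nonneg \<tau>]
      by (auto simp: is_LT_def homogeneous_def)
  qed
  show "separating Z F"
    unfolding separating_def using dom LT term_ordering_block_ordering[of \<tau>, OF \<tau>] by blast
qed

text \<open>The remainder at a position is determined as \<open>var z - f\<close>, which eliminates
  the existential quantifier.\<close>

lemma coherently_separating_iff_free_of:
  fixes F :: "('n, 'k::comm_ring_1) mpoly tuple"
  shows "coherently_separating Z F \<longleftrightarrow> dom F = dom Z \<and>
    (\<forall>i f z. F i = Some f \<longrightarrow> Z i = Some z \<longrightarrow> free_of (ran Z) (var z - f))"
    (is "_ \<longleftrightarrow> _ \<and> ?R")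
proof (cases "dom F = dom Z")
  case True
  have "coherently_separating Z F \<longleftrightarrow> ?R"
  proof
    assume "coherently_separating Z F"
    then obtain h where h: "\<And>i. i \<in> dom Z \<Longrightarrow> the (F i) = var (the (Z i)) - h i"
        "\<And>i j t. i \<in> dom Z \<Longrightarrow> j \<in> dom Z \<Longrightarrow> t \<in> Poly_Mapping.keys (h j) \<Longrightarrow> \<not> var_dvd (the (Z i)) t"
      unfolding coherently_separating_def by blast
    show ?R
      unfolding free_of_def
    proof (intro allI impI ballI)
      fix i f z t x
      assume f: "F i = Some f" and z: "Z i = Some z"
        and t: "t \<in> Poly_Mapping.keys (var z - f)" and "x \<in> ran Z"
      then obtain j where j: "Z j = Some x" by (auto simp: ran_def)
      have "var z - f = h i" using h(1)[of i] f z by (simp add: domI)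
      then show "\<not> var_dvd x t" using h(2)[of j i t] j z t by (simp add: domI)
    qed
  next
    assume R: ?R
    show "coherently_separating Z F"
      unfolding coherently_separating_def
    proof (intro conjI True exI[of _ "\<lambda>i. var (the (Z i)) - the (F i)"] ballI)
      fix i j t
      assume ij: "i \<in> dom Z" "j \<in> dom Z"
        and t: "t \<in> Poly_Mapping.keys (var (the (Z j)) - the (F j))"
      obtain f where f: "F j = Some f" using ij True by blast
      obtain z where z: "Z j = Some z" using ij by blast
      obtain x where x: "Z i = Some x" using ij by blast
      show "\<not> var_dvd (the (Z i)) t"
        using R f z x t ranI[of Z i x] unfolding free_of_def by auto
    qed simp
  qed
  then show ?thesis using True by simp
qed (simp add: coherently_separating_def)

text \<open>A term of degree \<open>W z\<close> is divisible only by indeterminates of degree at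
  most \<open>W z\<close>. Coherence in that degree excludes those of equal degree, and reducedness
  those of smaller degree.\<close>

lemma coherently_separating_iff_graded:
  fixes F :: "('n::finite, 'k::comm_ring_1) mpoly tuple"
  assumes nonneg: "\<And>x. 0 \<le> W x"
    and dom: "dom F = dom Z"
    and hom: "\<And>f. f \<in> ran F \<Longrightarrow> \<exists>d. homogeneous W d f"
    and pos: "\<And>f t. f \<in> ran F \<Longrightarrow> t \<in> Poly_Mapping.keys f \<Longrightarrow> 1 \<le> wdeg W t"
  shows "coherently_separating Z F \<longleftrightarrow>
    (\<forall>d\<ge>1. coherently_separating (deg_vars W d Z) (deg_polys W d F) \<and>
      (\<forall>d'<d. reduced_wrt (deg_vars W d' Z) (deg_polys W d F)))"
proof
  assume L: "coherently_separating Z F"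
  have free: "free_of (ran Z) (var z - f)" if "F i = Some f" "Z i = Some z" for i f z
    using L that by (simp add: coherently_separating_iff_free_of)
  have key: "var_term x \<in> Poly_Mapping.keys f \<longleftrightarrow> x = z" if "F i = Some f" "Z i = Some z" "x \<in> ran Z"
    for i f z x
    using var_term_in_keys_var_minus[OF free[OF that(1,2)] that(3), of z] by simp
  have dom_d: "dom (deg_polys W d F) = dom (deg_vars W d Z)" for d
    by (rule dom_deg_polys_eq[OF dom hom]) (auto simp: key ranI)
  show "\<forall>d\<ge>1. coherently_separating (deg_vars W d Z) (deg_polys W d F) \<and>
      (\<forall>d'<d. reduced_wrt (deg_vars W d' Z) (deg_polys W d F))"
  proof (intro allI impI conjI)
    fix d
    show "coherently_separating (deg_vars W d Z) (deg_polys W d F)"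
      unfolding coherently_separating_iff_free_of ran_deg_vars
      using free dom_d by (auto simp: deg_vars_def deg_polys_def subtuple_eq_Some free_of_def)
    fix d' assume "d' < d"
    show "reduced_wrt (deg_vars W d' Z) (deg_polys W d F)"
      unfolding reduced_wrt_def ran_deg_vars
    proof (intro ballI notI)
      fix f t x
      assume "f \<in> ran (deg_polys W d F)" and t: "t \<in> Poly_Mapping.keys f"
        and x: "x \<in> {z \<in> ran Z. W z = d'}" "var_dvd x t"
      then obtain i where i: "F i = Some f" "homogeneous W d f"
        by (auto simp: ran_def deg_polys_def subtuple_eq_Some)
      then obtain z where z: "Z i = Some z" using dom by blast
      have "var_term z \<in> Poly_Mapping.keys f" using key[OF i(1) z] z by (simp add: ranI)
      then have "W z = d" using i(2) by (auto simp: homogeneous_def)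
      show False
      \<comment> \<open>Subtraction from \<open>var z\<close> affects the support only at
        \<open>z\<close>, and \<open>z\<close> is not divisible by \<open>x\<close>, whose degree
        \<open>d'\<close> is smaller.\<close>
      proof (cases "t = var_term z")
        case True
        then show ?thesis using x \<open>W z = d\<close> \<open>d' < d\<close> by auto
      next
        case False
        then have "t \<in> Poly_Mapping.keys (var z - f)"
          using t by (simp add: in_keys_iff lookup_minus var_def lookup_single when_def)
        then show ?thesis using free[OF i(1) z] x by (auto simp: free_of_def)
      qed
    qed
  qed
next
  assume R: "\<forall>d\<ge>1. coherently_separating (deg_vars W d Z) (deg_polys W d F) \<and>
      (\<forall>d'<d. reduced_wrt (deg_vars W d' Z) (deg_polys W d F))"
  then have dom_d: "dom (deg_polys W d F) = dom (deg_vars W d Z)" if "1 \<le> d" for d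
    using that by (simp add: coherently_separating_def)
  show "coherently_separating Z F"
    unfolding coherently_separating_iff_free_of free_of_def
  proof (intro conjI dom allI impI ballI notI)
    fix i f z t x
    assume f: "F i = Some f" and z: "Z i = Some z"
      and t: "t \<in> Poly_Mapping.keys (var z - f)" and x: "x \<in> ran Z" "var_dvd x t"
    have fran: "f \<in> ran F" using f by (rule ranI)
    have d: "1 \<le> W z" "homogeneous W (W z) f"
      using entry_degree[OF dom_d hom[OF fran] pos[OF fran] f z] by auto
    have fd: "deg_polys W (W z) F i = Some f" and zd: "deg_vars W (W z) Z i = Some z"
      using f z d by (auto simp: deg_polys_def deg_vars_def subtuple_eq_Some)
    have "coherently_separating (deg_vars W (W z) Z) (deg_polys W (W z) F)"
      using R d(1) by blast
    then have coh: "free_of {x \<in> ran Z. W x = W z} (var z - f)"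
      using fd zd unfolding coherently_separating_iff_free_of ran_deg_vars by blast
    have "wdeg W t = W z"
      using t d(2) by (cases rule: keys_minus_cases) (auto simp: homogeneous_def)
    then have "W x \<le> W z" using wdeg_ge_var[of W x t, OF nonneg x(2)] by simp
    moreover have "W x \<noteq> W z" using coh t x by (auto simp: free_of_def)
    ultimately have "W x < W z" by simp
    then have red: "reduced_wrt (deg_vars W (W x) Z) (deg_polys W (W z) F)"
      using R d(1) by blast
    from t show False
    proof (cases rule: keys_minus_cases)
      case 1
      then show False using x(2) \<open>W x \<noteq> W z\<close> by simp
    next
      case 2
      then show False
        using red x ranI[of "deg_polys W (W z) F", OF fd] unfolding reduced_wrt_def ran_deg_vars by blast
    qed
  qed
qed

text \<open>A homogeneous element of I of degree d need not lie in I_d. Therefore (a) and (b) are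
  given twice: for the sum of the ideals up to d, and for I_d with membership of all
  \<open>F_d\<close> in I_d stated on the left as well. In (c) the condition on \<open>ran Z\<close>
  excludes indeterminates of degree 0, which appear in no \<open>Z_d\<close> with d at least 1 but
  cannot be separated in I.\<close>

theorem proposition4p5:
  fixes W :: "'n::finite \<Rightarrow> int"
    and G :: "('n, 'k::field) mpoly tuple"
    and I :: "('n, 'k) mpoly set"
    and Z :: "'n tuple"
    and r s :: nat
  assumes nonneg: "\<And>x. 0 \<le> W x"
    and G_tuple: "dom G = {1..r}"
    and G_hom: "\<And>g. g \<in> ran G \<Longrightarrow> \<exists>d\<ge>1. homogeneous W d g"
    and I_gen: "I = ideal_gen (ran G)"
    and Z_tuple: "dom Z = {1..s}"
    and Z_distinct: "distinct_entries Z"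
  shows
    "(\<forall>F. dom F = {1..s} \<and> (\<forall>f\<in>ran F. \<exists>d. homogeneous W d f) \<and> ran F \<subseteq> I \<longrightarrow>
        (separating Z F \<longleftrightarrow>
           (\<forall>d\<ge>1. separating_for (deg_le_ideal W d G) (deg_vars W d Z) (deg_polys W d F))) \<and>
        (separating Z F \<and> (\<forall>d\<ge>1. ran (deg_polys W d F) \<subseteq> deg_ideal W d G) \<longleftrightarrow>
           (\<forall>d\<ge>1. separating_for (deg_ideal W d G) (deg_vars W d Z) (deg_polys W d F)))) \<and>
     (\<forall>F. dom F = {1..s} \<and> (\<forall>f\<in>ran F. \<exists>d. homogeneous W d f) \<and> ran F \<subseteq> I \<longrightarrow>
        (coherently_separating Z F \<longleftrightarrow>
           (\<forall>d\<ge>1. coherently_separating_for (deg_le_ideal W d G) (deg_vars W d Z) (deg_polys W d F) \<and>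
                   (\<forall>d'<d. reduced_wrt (deg_vars W d' Z) (deg_polys W d F)))) \<and>
        (coherently_separating Z F \<and> (\<forall>d\<ge>1. ran (deg_polys W d F) \<subseteq> deg_ideal W d G) \<longleftrightarrow>
           (\<forall>d\<ge>1. coherently_separating_for (deg_ideal W d G) (deg_vars W d Z) (deg_polys W d F) \<and>
                   (\<forall>d'<d. reduced_wrt (deg_vars W d' Z) (deg_polys W d F))))) \<and>
     (best_tuple I Z \<longleftrightarrow>
        (\<forall>z\<in>ran Z. 1 \<le> W z) \<and>
        (\<forall>d\<ge>1. best_tuple (deg_ideal W d G) (deg_vars W d Z)))"
proof -
  \<comment> \<open>Separation splits by degree without reference to the smaller ideals. Membership
    in \<open>deg_le_ideal\<close> is then automatic, while membership in \<open>deg_ideal\<close>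
    is carried along on both sides.\<close>
  have F: "(separating Z F \<longleftrightarrow> (\<forall>d\<ge>1. separating (deg_vars W d Z) (deg_polys W d F))) \<and>
      (coherently_separating Z F \<longleftrightarrow>
        (\<forall>d\<ge>1. coherently_separating (deg_vars W d Z) (deg_polys W d F) \<and>
          (\<forall>d'<d. reduced_wrt (deg_vars W d' Z) (deg_polys W d F)))) \<and>
      (\<forall>d. ran (deg_polys W d F) \<subseteq> deg_le_ideal W d G)"
    if "dom F = {1..s}" "\<forall>f\<in>ran F. \<exists>d. homogeneous W d f" "ran F \<subseteq> I" for F
  proof -
    have dom: "dom F = dom Z" using that(1) Z_tuple by simp
    have pos: "1 \<le> wdeg W t" if "f \<in> ran F" "t \<in> Poly_Mapping.keys f" for f t
      using wdeg_ge_of_ideal_gen[of W "ran G", OF nonneg G_hom _ that(2)] that(1) \<open>ran F \<subseteq> I\<close> I_gen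
      by blast
    have hom: "\<exists>d. homogeneous W d f" if "f \<in> ran F" for f
      using that \<open>\<forall>f\<in>ran F. \<exists>d. homogeneous W d f\<close> by blast
    have "separating Z F \<longleftrightarrow> (\<forall>d\<ge>1. separating (deg_vars W d Z) (deg_polys W d F))"
      by (rule separating_iff_graded) (fact nonneg dom hom pos)+
    moreover have "coherently_separating Z F \<longleftrightarrow>
        (\<forall>d\<ge>1. coherently_separating (deg_vars W d Z) (deg_polys W d F) \<and>
          (\<forall>d'<d. reduced_wrt (deg_vars W d' Z) (deg_polys W d F)))"
      by (rule coherently_separating_iff_graded) (fact nonneg dom hom pos)+
    moreover have "ran (deg_polys W d F) \<subseteq> deg_le_ideal W d G" for d
      by (rule deg_polys_subset_deg_le_ideal) (use nonneg G_hom that(3) I_gen in auto)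
    ultimately show ?thesis by blast
  qed
  have c: "best_tuple I Z \<longleftrightarrow> (\<forall>z\<in>ran Z. 1 \<le> W z) \<and>
      (\<forall>d\<ge>1. best_tuple (deg_ideal W d G) (deg_vars W d Z))"
    unfolding I_gen by (rule best_tuple_iff_graded) (fact nonneg G_hom Z_distinct)+
  show ?thesis
    unfolding separating_for_def coherently_separating_for_def
  proof (intro conjI allI impI c, goal_cases)
    case (1 F)
    then show ?case using F[of F] by blast
  next
    case (2 F)
    then show ?case using F[of F] by blast
  next
    case (3 F)
    then show ?case using F[of F] by blast
  next
    case (4 F)
    then show ?case using F[of F] by blast
  qed
qed

end
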